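(* Let $n\ge1$ be an integer and let $0\le d_1<\dots<d_k<q$ be integers with $k\ge2$ (possibly with carryover, i.e. possibly $nd_k\ge q$). For every integer $t\geq 1$ with $t>\log_q n$, $$\left|\alpha_{2n}(\mathcal{E}_q^{\{d_1,\dots,d_k\}})-\frac{\log A_{2n,1}([\mathcal{E}_q^{\{d_1,\dots,d_k\}}]_t)}{\log k^t}\right|\le\frac{\log(2n+1)}{2nt\log k},$$ and therefore $$\alpha_{2n}(\mathcal{E}_q^{\{d_1,\dots,d_k\}})=\lim_{t\to\infty}\frac{\log A_{2n,1}([\mathcal{E}_q^{\{d_1,\dots,d_k\}}]_t)}{\log k^t}.$$
   Context: For integers $0\le d_1<\dots<d_k<q$ and $j\ge1$, $[\mathcal{E}_q^{\{d_1,\dots,d_k\}}]_j$ is the set of integers of the form $\sum_{s=0}^{j-1}a_sq^s$ with all $a_s\in\{d_1,\dots,d_k\}$; the ellipsephic set $\mathcal{E}_q^{\{d_1,\dots,d_k\}}$ is the union of these over $j\geq 1$. For $S\subset\mathbb{Z}^m$, $A_{p,m}(S)$ is the best constant such that $$\Big\|\sum_{\ell\in S}a(\ell)e(\ell\cdot x)\Big\|_{L^p([0,1]^m)}\le A_{p,m}(S)\Big(\sum_{\ell\in S}|a(\ell)|^2\Big)^{1/2}$$ for all $a:S\to\mathbb{R}_{\ge0}$, where $e(t)=e^{2\pi it}$. The decoupling exponent is $$\alpha_{2n}(\mathcal{E}_q^{\{d_1,\dots,d_k\}})=\limsup_{j\to\infty}\frac{\log A_{2n,1}([\mathcal{E}_q^{\{d_1,\dots,d_k\}}]_j)}{\log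 k^j}.$$ *)

theory Defs
  imports "HOL-Analysis.Analysis"
begin

definition ellipsephic_level :: "int \<Rightarrow> int set \<Rightarrow> nat \<Rightarrow> int set" where
  "ellipsephic_level q D j = {\<Sum>s<j. a s * q ^ s |a :: nat \<Rightarrow> int. \<forall>s<j. a s \<in> D}"

definition expi :: "real \<Rightarrow> complex" where
  "expi t = exp (2 * complex_of_real pi * \<i> * complex_of_real t)"

definition Lp_norm :: "real \<Rightarrow> (real \<Rightarrow> complex) \<Rightarrow> real" where
  "Lp_norm p f = (LINT x:{0..1}|lborel. cmod (f x) powr p) powr (1 / p)"

text \<open>
  Best constant in the one-dimensional case \<open>m = 1\<close>, for finite \<open>S\<close>
  (for infinite \<open>S\<close> the sums below are junk).
  The admissible constants form a closed subset of the half-line, so the infimum is attained;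
  the condition \<open>0 \<le> C\<close> only matters for empty \<open>S\<close>.
\<close>

definition best_const :: "real \<Rightarrow> int set \<Rightarrow> real" where
  "best_const p S = Inf {C. 0 \<le> C \<and>
     (\<forall>a :: int \<Rightarrow> real. (\<forall>l\<in>S. 0 \<le> a l) \<longrightarrow>
        Lp_norm p (\<lambda>x. \<Sum>l\<in>S. complex_of_real (a l) * expi (real_of_int l * x))
          \<le> C * sqrt (\<Sum>l\<in>S. \<bar>a l\<bar>\<^sup>2))}"

text \<open>
  The upper limit is taken in the extended reals, so that finiteness of the exponent is not
  built into the definition.
\<close>

definition decoupling_exponent :: "real \<Rightarrow> int \<Rightarrow> int set \<Rightarrow> ereal" where
  "decoupling_exponent p q D =
     limsup (\<lambda>j. ereal (ln (best_const p (ellipsephic_level q D j)) / ln (real (card D) ^ j)))"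

end

theory Submission
  imports Defs
begin

text \<open>
  By orthogonality, \<open>\<parallel>f\<parallel>\<^sub>2\<^sub>n\<^sup>2\<^sup>n\<close> for \<open>f\<close> with coefficients \<open>a\<close> is the number of solutions of
  \<open>l\<^sub>1 + \<dots> + l\<^sub>n = l\<^sub>n\<^sub>+\<^sub>1 + \<dots> + l\<^sub>2\<^sub>n\<close>, each weighted by \<open>a(l\<^sub>1) \<cdots> a(l\<^sub>2\<^sub>n)\<close>. Write \<open>A\<^sub>t\<close> for the best
  constant of the \<open>t\<close>-digit set \<open>E\<^sub>t\<close>; then \<open>E\<^sub>t\<^sub>+\<^sub>u = E\<^sub>t + q\<^sup>t E\<^sub>u\<close>. Product weights and the
  solutions without carry give \<open>A\<^sub>t A\<^sub>u \<le> A\<^sub>t\<^sub>+\<^sub>u\<close>. Conversely, every solution over \<open>E\<^sub>t\<^sub>+\<^sub>u\<close> has a carry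
  \<open>h\<close> with \<open>\<bar>h\<bar> < n\<close>, and the solutions with a given carry are controlled by AM-GM applied to the
  normalised fibres of \<open>a\<close> over the high digits, so \<open>A\<^sub>t\<^sub>+\<^sub>u\<^sup>2\<^sup>n \<le> (2n - 1) (A\<^sub>t A\<^sub>u)\<^sup>2\<^sup>n\<close>. Hence
  \<open>ln A\<^sub>t\<close> is additive up to a bounded error, and \<open>ln A\<^sub>t / t\<close> converges at rate \<open>O(1/t)\<close>.
\<close>

section \<open>Almost additive sequences\<close>

text \<open>Iterating the hypotheses puts \<open>L (m * t)\<close> within \<open>m * c\<close> of
  \<open>m * L t\<close>, so passing to a multiple of \<open>t\<close> moves the ratio
  \<open>L t / t\<close> by at most \<open>c / t\<close>. This makes the ratios Cauchy and keeps the
  error explicit.\<close>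

lemma two_sided_fekete:
  fixes L :: "nat \<Rightarrow> real"
  assumes super: "\<And>s t. L s + L t \<le> L (s + t)"
    and sub: "\<And>s t. L (s + t) \<le> L s + L t + c"
  obtains \<alpha> where "(\<lambda>t. L t / real t) \<longlonglongrightarrow> \<alpha>"
    and "\<And>t. t \<ge> 1 \<Longrightarrow> \<bar>\<alpha> - L t / real t\<bar> \<le> c / real t"
proof -
  have c0: "0 \<le> c" using super[of 0 0] sub[of 0 0] by linarith
  have mult: "real m * L t \<le> L (m * t) \<and> L (m * t) \<le> real m * L t + real m * c"
    if "m \<ge> 1" for m t
    using that
  proof (induction m rule: dec_induct)
    case base
    then show ?case using c0 by simp
  next
    case (step m)
    then show ?case
      using super[of t "m * t"] sub[of t "m * t"] by (simp add: algebra_simps)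
  qed
  have near: "\<bar>L (m * t) / real (m * t) - L t / real t\<bar> \<le> c / real t"
    if "m \<ge> 1" "t \<ge> 1" for m t
  proof -
    have eq: "L (m * t) / real (m * t) - L t / real t
      = (L (m * t) - real m * L t) / (real m * real t)"
      using that by (simp add: field_simps)
    have "\<bar>L (m * t) - real m * L t\<bar> \<le> real m * c" using mult[OF that(1), of t] by linarith
    then have "\<bar>L (m * t) - real m * L t\<bar> / (real m * real t) \<le> real m * c / (real m * real t)"
      by (intro divide_right_mono) auto
    then show ?thesis unfolding eq using that by (simp add: abs_divide abs_mult)
  qed
  \<comment> \<open>Both ratios are compared with the one at the common multiple
    \<open>s * t\<close>.\<close>
  have pair: "\<bar>L s / real s - L t / real t\<bar> \<le> c / real s + c / real t"
    if "s \<ge> 1" "t \<ge> 1" for s t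
    using near[OF that] near[OF that(2,1)] by (simp add: mult.commute)
  have c_lim: "(\<lambda>t. c / real t) \<longlonglongrightarrow> 0"
    by (rule lim_const_over_n)
  have "Cauchy (\<lambda>t. L t / real t)"
  proof (rule metric_CauchyI)
    fix e :: real assume "e > 0"
    then have "\<forall>\<^sub>F t in sequentially. c / real t < e / 2"
      using c_lim by (intro order_tendstoD) auto
    then obtain M where M: "\<And>t. t \<ge> M \<Longrightarrow> c / real t < e / 2"
      by (auto simp: eventually_sequentially)
    have "dist (L s / real s) (L t / real t) < e" if "s \<ge> max 1 M" "t \<ge> max 1 M" for s t
      using pair[of s t] M[of s] M[of t] that unfolding dist_real_def by linarith
    then show "\<exists>M. \<forall>m\<ge>M. \<forall>n\<ge>M. dist (L m / real m) (L n / real n) < e" by blast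
  qed
  then obtain \<alpha> where \<alpha>: "(\<lambda>t. L t / real t) \<longlonglongrightarrow> \<alpha>"
    using Cauchy_convergent convergent_def by blast
  \<comment> \<open>With \<open>t\<close> fixed and \<open>s\<close> tending to infinity in
    \<open>pair\<close>, the term \<open>c / s\<close> disappears.\<close>
  have "\<bar>\<alpha> - L t / real t\<bar> \<le> c / real t" if "t \<ge> 1" for t
  proof (rule tendsto_le)
    show "(\<lambda>s. \<bar>L s / real s - L t / real t\<bar>) \<longlonglongrightarrow> \<bar>\<alpha> - L t / real t\<bar>"
      by (intro tendsto_intros \<alpha>)
    show "(\<lambda>s. c / real s + c / real t) \<longlonglongrightarrow> c / real t"
      using tendsto_add[OF c_lim tendsto_const] by simp
    show "\<forall>\<^sub>F s in sequentially. \<bar>L s / real s - L t / real t\<bar> \<le> c / real s + c / real t"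
      using pair that by (intro eventually_sequentiallyI[of 1]) auto
  qed simp
  with \<alpha> that show ?thesis by blast
qed

section \<open>Digit sets\<close>

text \<open>This range makes the low digits recoverable as a remainder and later bounds the
  carries.\<close>

lemma ellipsephic_level_subset:
  assumes "\<And>x. x \<in> D \<Longrightarrow> 0 \<le> x \<and> x < q"
  shows "ellipsephic_level q D j \<subseteq> {0..<q ^ j}"
proof
  fix y assume "y \<in> ellipsephic_level q D j"
  then obtain a where a: "\<forall>s<j. a s \<in> D" and y: "y = (\<Sum>s<j. a s * q ^ s)"
    by (auto simp: ellipsephic_level_def)
  have "0 \<le> (\<Sum>s<j. a s * q ^ s) \<and> (\<Sum>s<j. a s * q ^ s) < q ^ j"
    using a
  proof (induction j)
    case (Suc j)
    then have d: "0 \<le> a j" "a j + 1 \<le> q" using assms[of "a j"] by auto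
    \<comment> \<open>A leading digit of at most \<open>q - 1\<close> leaves room for one more
      \<open>q ^ j\<close>, the bound on the lower digits.\<close>
    then have "q ^ j * (a j + 1) \<le> q ^ j * q"
      by (intro mult_left_mono) simp_all
    moreover have "0 \<le> a j * q ^ j" using d by simp
    moreover note Suc
    ultimately show ?case by (simp add: algebra_simps)
  qed simp
  with y show "y \<in> {0..<q ^ j}" by simp
qed

lemma ellipsephic_level_nonempty:
  assumes "D \<noteq> {}"
  shows "ellipsephic_level q D j \<noteq> {}"
proof -
  obtain x where "x \<in> D" using assms by blast
  then have "\<exists>a :: nat \<Rightarrow> int. \<forall>s<j. a s \<in> D" by (intro exI[of _ "\<lambda>_. x"]) simp
  then show ?thesis unfolding ellipsephic_level_def by blast
qed

text \<open>The lowest \<open>t\<close> digits and the \<open>u\<close> digits above them are chosen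
  independently. This self-similarity reduces scale \<open>t + u\<close> to the scales
  \<open>t\<close> and \<open>u\<close>, including level 0, which is \<open>{0}\<close>.\<close>

lemma ellipsephic_level_add:
  "ellipsephic_level q D (t + u)
     = (\<lambda>(l, m). l + q ^ t * m) ` (ellipsephic_level q D t \<times> ellipsephic_level q D u)"
    (is "_ = ?R")
proof
  have split: "(\<Sum>s<t + u. a s * q ^ s)
      = (\<Sum>s<t. a s * q ^ s) + q ^ t * (\<Sum>s<u. a (t + s) * q ^ s)" for a :: "nat \<Rightarrow> int"
  proof -
    have "(\<Sum>s<t + u. a s * q ^ s) = (\<Sum>s<t. a s * q ^ s) + (\<Sum>s=0..<u. a (s + t) * q ^ (s + t))"
      using sum.shift_bounds_nat_ivl[of "\<lambda>s. a s * q ^ s" 0 t u]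
        sum.atLeastLessThan_concat[of 0 t "t + u" "\<lambda>s. a s * q ^ s"]
      by (simp add: lessThan_atLeast0 add.commute)
    then show ?thesis
      by (simp add: sum_distrib_left lessThan_atLeast0 power_add ac_simps)
  qed
  show "ellipsephic_level q D (t + u) \<subseteq> ?R"
  proof
    fix y assume "y \<in> ellipsephic_level q D (t + u)"
    then obtain a where a: "\<forall>s<t+u. a s \<in> D" and y: "y = (\<Sum>s<t+u. a s * q ^ s)"
      by (auto simp: ellipsephic_level_def)
    have "(\<Sum>s<t. a s * q ^ s) \<in> ellipsephic_level q D t"
      "(\<Sum>s<u. a (t + s) * q ^ s) \<in> ellipsephic_level q D u"
      using a unfolding ellipsephic_level_def by (force, force)
    then show "y \<in> ?R" unfolding y split by force
  qed
  show "?R \<subseteq> ellipsephic_level q D (t + u)"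
  proof clarify
    fix l m assume "l \<in> ellipsephic_level q D t" "m \<in> ellipsephic_level q D u"
    then obtain a b where a: "\<forall>s<t. a s \<in> D" "l = (\<Sum>s<t. a s * q ^ s)"
      and b: "\<forall>s<u. b s \<in> D" "m = (\<Sum>s<u. b s * q ^ s)"
      by (auto simp: ellipsephic_level_def)
    define c where "c s = (if s < t then a s else b (s - t))" for s
    have "l + q ^ t * m = (\<Sum>s<t + u. c s * q ^ s)"
      unfolding split a b by (simp add: c_def)
    moreover have "\<forall>s<t+u. c s \<in> D" using a b by (auto simp: c_def)
    ultimately show "l + q ^ t * m \<in> ellipsephic_level q D (t + u)"
      unfolding ellipsephic_level_def by blast
  qed
qed

section \<open>Weighted solution counts and orthogonality\<close>

text \<open>Both sides of the equation form one family of \<open>2 * n\<close> variables, with signs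
  marking the side, so that products over all variables run over a single index set.\<close>

definition signed_sum :: "nat \<Rightarrow> (nat \<Rightarrow> int) \<Rightarrow> int" where
  "signed_sum n g = (\<Sum>i<2 * n. if i < n then g i else - g i)"

text \<open>A right-hand side \<open>h\<close> is allowed because carries make the equations for the
  low and the high digits inhomogeneous.\<close>

definition tuples :: "nat \<Rightarrow> int set \<Rightarrow> int \<Rightarrow> (nat \<Rightarrow> int) set" where
  "tuples n S h = {g \<in> {..<2 * n} \<rightarrow>\<^sub>E S. signed_sum n g = h}"

text \<open>Each variable has its own weight, because once the high digits are fixed, different
  variables see different fibres of the coefficients. For \<open>n = 2\<close>, \<open>h = 0\<close>
  and all weights 1 this is the classical additive energy of \<open>S\<close>.\<close>

definition mixed_energy :: "nat \<Rightarrow> int set \<Rightarrow> int \<Rightarrow> (nat \<Rightarrow> int \<Rightarrow> real) \<Rightarrow> real" where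
  "mixed_energy n S h a = (\<Sum>g\<in>tuples n S h. \<Prod>i<2 * n. a i (g i))"

abbreviation energy :: "nat \<Rightarrow> int set \<Rightarrow> (int \<Rightarrow> real) \<Rightarrow> real" where
  "energy n S a \<equiv> mixed_energy n S 0 (\<lambda>_. a)"

definition trig_poly :: "int set \<Rightarrow> (int \<Rightarrow> real) \<Rightarrow> real \<Rightarrow> complex" where
  "trig_poly S a x = (\<Sum>l\<in>S. complex_of_real (a l) * expi (real_of_int l * x))"

lemma expi_add: "expi (x + y) = expi x * expi y"
  by (simp add: expi_def distrib_left exp_add)

lemma expi_0: "expi 0 = 1"
  by (simp add: expi_def)

lemma cnj_expi: "cnj (expi x) = expi (- x)"
  by (simp add: expi_def exp_cnj)

lemma norm_expi: "cmod (expi x) = 1"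
  by (simp add: expi_def)

lemma expi_sum: "finite I \<Longrightarrow> expi (\<Sum>i\<in>I. f i) = (\<Prod>i\<in>I. expi (f i))"
  by (induction I rule: finite_induct) (simp_all add: expi_add expi_0)

lemma continuous_on_expi [continuous_intros]:
  "continuous_on A f \<Longrightarrow> continuous_on A (\<lambda>x. expi (f x))"
  unfolding expi_def by (intro continuous_intros)

lemma continuous_on_trig_poly [continuous_intros]: "continuous_on A (trig_poly S a)"
  unfolding trig_poly_def by (intro continuous_intros)

lemma set_integral_finite_sum:
  fixes f :: "'i \<Rightarrow> 'a \<Rightarrow> 'b :: {banach, second_countable_topology}"
  assumes "\<And>i. i \<in> I \<Longrightarrow> set_integrable M A (f i)"
  shows "(LINT x:A|M. (\<Sum>i\<in>I. f i x)) = (\<Sum>i\<in>I. LINT x:A|M. f i x)"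
  using assms unfolding set_lebesgue_integral_def set_integrable_def
  by (simp add: scaleR_sum_right Bochner_Integration.integral_sum)

lemma integral_expi:
  "(LINT x:{0..1}|lborel. expi (real_of_int h * x)) = (if h = 0 then 1 else 0)"
proof (cases "h = 0")
  case True
  then show ?thesis
    using integral_FTC_atLeastAtMost[of 0 1 "of_real :: real \<Rightarrow> complex" "\<lambda>_. 1"]
    by (simp add: expi_0 set_lebesgue_integral_def has_vector_derivative_of_real)
next
  case False
  \<comment> \<open>\<open>w\<close> is a nonzero integer multiple of 2 pi i, so the antiderivative
    \<open>exp (w * x) / w\<close> takes the same value at 0 and at 1.\<close>
  define w where "w = 2 * complex_of_real pi * \<i> * of_int h"
  have w: "w \<noteq> 0" using False by (simp add: w_def)
  have eq: "expi (real_of_int h * x) = exp (w * of_real x)" for x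
    by (simp add: expi_def w_def mult_ac)
  have "(LINT x:{0..1}|lborel. expi (real_of_int h * x)) =
     exp (w * of_real 1) / w - exp (w * of_real 0) / w"
    unfolding set_lebesgue_integral_def
  proof (rule integral_FTC_atLeastAtMost)
    fix x :: real
    have "((\<lambda>z. exp (w * z) / w) has_field_derivative exp (w * of_real x)) (at (of_real x))"
      using w by (auto intro!: derivative_eq_intros)
    then show "((\<lambda>x. exp (w * of_real x) / w) has_vector_derivative expi (real_of_int h * x))
      (at x within {0..1})"
      unfolding eq by (rule has_vector_derivative_real_field)
  qed (auto intro!: continuous_intros)
  also have "exp w = 1"
    unfolding w_def exp_eq_1 by (auto simp: mult_ac)
  then have "exp (w * of_real 1) / w - exp (w * of_real 0) / w = 0" by simp
  finally show ?thesis using False by simp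
qed

lemma finite_tuples [simp]: "finite S \<Longrightarrow> finite (tuples n S h)"
  unfolding tuples_def by (simp add: finite_PiE)

lemma mixed_energy_nonneg:
  assumes "\<And>i l. i < 2 * n \<Longrightarrow> l \<in> S \<Longrightarrow> 0 \<le> a i l"
  shows "0 \<le> mixed_energy n S h a"
  unfolding mixed_energy_def tuples_def
  using assms by (auto intro!: sum_nonneg prod_nonneg simp: PiE_iff)

text \<open>Conjugating the last \<open>n\<close> factors negates their frequencies, which produces
  the minus signs of \<open>signed_sum\<close>.\<close>

definition signed_trig :: "nat \<Rightarrow> int set \<Rightarrow> (nat \<Rightarrow> int \<Rightarrow> real) \<Rightarrow> nat \<Rightarrow> real \<Rightarrow> complex" where
  "signed_trig n S a i x = (if i < n then trig_poly S (a i) x else cnj (trig_poly S (a i) x))"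

lemma continuous_on_signed_trig [continuous_intros]: "continuous_on A (signed_trig n S a i)"
  unfolding signed_trig_def by (cases "i < n") (auto intro!: continuous_intros)

text \<open>Expanding the product gives one character per tuple \<open>g\<close>, of frequency
  \<open>signed_sum n g\<close>. The extra factor shifts all frequencies by \<open>- h\<close>, so
  integration keeps exactly the tuples with signed sum \<open>h\<close>.\<close>

lemma mixed_energy_eq_integral:
  assumes "finite S"
  shows "complex_of_real (mixed_energy n S h a)
    = (LINT x:{0..1}|lborel. (\<Prod>i<2 * n. signed_trig n S a i x) * expi (real_of_int (- h) * x))"
proof -
  have factor: "signed_trig n S a i x
      = (\<Sum>l\<in>S. of_real (a i l) * expi (real_of_int (if i < n then l else - l) * x))" for i x
    by (auto simp: signed_trig_def trig_poly_def cnj_expi)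
  have expand: "(\<Prod>i<2 * n. signed_trig n S a i x) * expi (real_of_int (- h) * x)
      = (\<Sum>g\<in>{..<2 * n} \<rightarrow>\<^sub>E S. of_real (\<Prod>i<2 * n. a i (g i))
          * expi (real_of_int (signed_sum n g - h) * x))" for x
  proof -
    have phase: "(\<Prod>i<2 * n. expi (real_of_int (if i < n then g i else - g i) * x))
        = expi (real_of_int (signed_sum n g) * x)" for g
      by (subst expi_sum[symmetric]) (simp_all add: signed_sum_def sum_distrib_right)
    have "(\<Prod>i<2 * n. signed_trig n S a i x) =
       (\<Sum>g\<in>{..<2 * n} \<rightarrow>\<^sub>E S. \<Prod>i<2 * n. of_real (a i (g i))
          * expi (real_of_int (if i < n then g i else - g i) * x))"
      unfolding factor using assms by (subst prod_sum_PiE) auto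
    also have "\<dots> = (\<Sum>g\<in>{..<2 * n} \<rightarrow>\<^sub>E S. of_real (\<Prod>i<2 * n. a i (g i))
          * expi (real_of_int (signed_sum n g) * x))"
      unfolding prod.distrib phase by simp
    finally have "(\<Prod>i<2 * n. signed_trig n S a i x) * expi (real_of_int (- h) * x)
      = (\<Sum>g\<in>{..<2 * n} \<rightarrow>\<^sub>E S. of_real (\<Prod>i<2 * n. a i (g i))
          * expi (real_of_int (signed_sum n g) * x + real_of_int (- h) * x))"
      unfolding expi_add by (simp only: sum_distrib_right mult.assoc)
    then show ?thesis
      by (simp add: left_diff_distrib)
  qed
  have "(LINT x:{0..1}|lborel. (\<Prod>i<2 * n. signed_trig n S a i x) * expi (real_of_int (- h) * x))
     = (\<Sum>g\<in>{..<2 * n} \<rightarrow>\<^sub>E S. of_real (\<Prod>i<2 * n. a i (g i)) *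
         (LINT x:{0..1}|lborel. expi (real_of_int (signed_sum n g - h) * x)))"
    unfolding expand
    by (subst set_integral_finite_sum)
       (auto intro!: borel_integrable_atLeastAtMost' continuous_intros simp del: of_int_diff)
  also have "\<dots> = (\<Sum>g\<in>{..<2 * n} \<rightarrow>\<^sub>E S.
      of_real (if signed_sum n g = h then \<Prod>i<2 * n. a i (g i) else 0))"
    unfolding integral_expi by (intro sum.cong refl) simp
  also have "\<dots> = of_real (mixed_energy n S h a)"
    unfolding mixed_energy_def tuples_def
    using assms by (simp add: sum.inter_filter finite_PiE)
  finally show ?thesis by simp
qed

lemma energy_eq_integral:
  assumes "finite S"
  shows "energy n S a = (LINT x:{0..1}|lborel. cmod (trig_poly S a x) ^ (2 * n))"
proof -
  have "(\<Prod>i<2 * n. signed_trig n S (\<lambda>_. a) i x) = complex_of_real (cmod (trig_poly S a x) ^ (2 * n))"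
    for x
  proof -
    \<comment> \<open>The \<open>n\<close> plain factors pair with the \<open>n\<close> conjugated
      ones, giving the \<open>n\<close>-th power of the squared modulus.\<close>
    have "(\<Prod>i<2 * n. signed_trig n S (\<lambda>_. a) i x)
       = (\<Prod>i<n. trig_poly S a x) * (\<Prod>i=n..<2 * n. cnj (trig_poly S a x))"
      using prod.atLeastLessThan_concat[of 0 n "2 * n" "\<lambda>i. signed_trig n S (\<lambda>_. a) i x"]
      by (simp add: lessThan_atLeast0 signed_trig_def)
    also have "\<dots> = (trig_poly S a x * cnj (trig_poly S a x)) ^ n"
      by (simp add: power_mult_distrib)
    finally show ?thesis
      by (simp add: complex_norm_square[symmetric] power_mult)
  qed
  then have "complex_of_real (energy n S a)
      = (LINT x:{0..1}|lborel. complex_of_real (cmod (trig_poly S a x) ^ (2 * n)))"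
    unfolding mixed_energy_eq_integral[OF assms] by (simp add: expi_0)
  also have "\<dots> = of_real (LINT x:{0..1}|lborel. cmod (trig_poly S a x) ^ (2 * n))"
    by (rule set_integral_complex_of_real)
  finally show ?thesis using of_real_eq_iff by blast
qed

text \<open>Inside the integral the modulus removes the phase carrying \<open>h\<close>, and AM-GM
  bounds the product of the \<open>2 * n\<close> moduli by the mean of their \<open>2 * n\<close>-th
  powers, whose integrals are the energies of the single weights.\<close>

lemma mixed_energy_le:
  assumes "finite S" and "n \<ge> 1"
    and nonneg: "\<And>i l. i < 2 * n \<Longrightarrow> l \<in> S \<Longrightarrow> 0 \<le> a i l"
    and bound: "\<And>i. i < 2 * n \<Longrightarrow> energy n S (a i) \<le> M"
  shows "mixed_energy n S h a \<le> M"
proof -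
  have amgm: "(\<Prod>i<2 * n. y i) \<le> (\<Sum>i<2 * n. y i ^ (2 * n) / real (2 * n))"
    if "\<And>i. 0 \<le> y i" for y :: "nat \<Rightarrow> real"
  proof -
    \<comment> \<open>AM-GM is applied to the \<open>2 * n\<close>-th powers, so that the geometric
      mean is the product itself.\<close>
    have "((\<Prod>i<2 * n. y i) ^ (2 * n)) powr (1 / real (2 * n))
        \<le> (\<Sum>i<2 * n. y i ^ (2 * n) / real (2 * n))"
      using arith_geom_mean[of "{..<2 * n}" "\<lambda>i. y i ^ (2 * n)"] that \<open>n \<ge> 1\<close>
      by (simp add: prod_power_distrib lessThan_empty_iff)
    moreover have "((\<Prod>i<2 * n. y i) ^ (2 * n)) powr (1 / real (2 * n)) = (\<Prod>i<2 * n. y i)"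
      using \<open>n \<ge> 1\<close> that powr_realpow'[of "\<Prod>i<2 * n. y i" "2 * n"]
      by (simp add: prod_nonneg powr_powr flip: powr_realpow')
    ultimately show ?thesis by simp
  qed
  have int: "set_integrable lborel {0..1} (\<lambda>x. cmod (trig_poly S b x) ^ m)" for b m
    by (intro borel_integrable_atLeastAtMost' continuous_intros)
  have "mixed_energy n S h a = cmod (complex_of_real (mixed_energy n S h a))"
    using mixed_energy_nonneg[of n S a h] nonneg by simp
  also have "\<dots> \<le> (LINT x:{0..1}|lborel.
      cmod ((\<Prod>i<2 * n. signed_trig n S a i x) * expi (real_of_int (- h) * x)))"
    unfolding mixed_energy_eq_integral[OF assms(1)]
    by (intro set_integral_norm_bound borel_integrable_atLeastAtMost' continuous_intros)
  also have "\<dots> = (LINT x:{0..1}|lborel. (\<Prod>i<2 * n. cmod (trig_poly S (a i) x)))"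
    by (simp add: norm_mult norm_expi prod_norm[symmetric] signed_trig_def if_distrib cong: if_cong)
  also have "\<dots> \<le> (LINT x:{0..1}|lborel.
      (\<Sum>i<2 * n. cmod (trig_poly S (a i) x) ^ (2 * n) / real (2 * n)))"
    by (intro set_integral_mono borel_integrable_atLeastAtMost' continuous_intros amgm) 
       (use \<open>n \<ge> 1\<close> in auto)
  also have "\<dots> = (\<Sum>i<2 * n. energy n S (a i) / real (2 * n))"
    unfolding energy_eq_integral[OF assms(1)]
    by (subst set_integral_finite_sum) (auto intro!: set_integrable_divide int)
  also have "\<dots> \<le> (\<Sum>i<2 * n. M / real (2 * n))"
    by (intro sum_mono divide_right_mono bound) auto
  also have "\<dots> = M" using \<open>n \<ge> 1\<close> by simp
  finally show ?thesis .
qed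


section \<open>The best constant in terms of energies\<close>

text \<open>Both sides of the defining inequality are nonnegative, so it may be raised to the power
  \<open>2 * n\<close>; the norm becomes an energy and the square root becomes an
  \<open>n\<close>-th power.\<close>

lemma best_const_energy:
  assumes "finite S" "n \<ge> 1"
  shows "best_const (real (2 * n)) S = Inf {C. 0 \<le> C \<and>
     (\<forall>a. (\<forall>l\<in>S. 0 \<le> a l) \<longrightarrow> energy n S a \<le> C ^ (2 * n) * (\<Sum>l\<in>S. (a l)\<^sup>2) ^ n)}"
proof -
  have "Lp_norm (real (2 * n)) (trig_poly S a) \<le> C * sqrt (\<Sum>l\<in>S. \<bar>a l\<bar>\<^sup>2)
     \<longleftrightarrow> energy n S a \<le> C ^ (2 * n) * (\<Sum>l\<in>S. (a l)\<^sup>2) ^ n"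
    if "0 \<le> C" "\<forall>l\<in>S. 0 \<le> a l" for C a
  proof -
    have pow: "cmod z powr real (2 * n) = cmod z ^ (2 * n)" for z
      using \<open>n \<ge> 1\<close> by (intro powr_realpow') auto
    have "0 \<le> energy n S a"
      using that(2) by (intro mixed_energy_nonneg) auto
    then have Lp: "Lp_norm (real (2 * n)) (trig_poly S a) = root (2 * n) (energy n S a)"
      unfolding Lp_norm_def pow energy_eq_integral[OF assms(1), symmetric]
      using \<open>n \<ge> 1\<close> by (intro root_powr_inverse[symmetric]) auto
    have rhs: "C ^ (2 * n) * (\<Sum>l\<in>S. (a l)\<^sup>2) ^ n = (C * sqrt (\<Sum>l\<in>S. \<bar>a l\<bar>\<^sup>2)) ^ (2 * n)"
      by (simp add: power_mult_distrib power_mult sum_nonneg)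
    have "root (2 * n) (energy n S a) \<le> C * sqrt (\<Sum>l\<in>S. \<bar>a l\<bar>\<^sup>2)
      \<longleftrightarrow> root (2 * n) (energy n S a) \<le> root (2 * n) ((C * sqrt (\<Sum>l\<in>S. \<bar>a l\<bar>\<^sup>2)) ^ (2 * n))"
      using \<open>n \<ge> 1\<close> that by (subst real_root_power_cancel) (auto simp: sum_nonneg)
    then show ?thesis
      unfolding Lp rhs using \<open>n \<ge> 1\<close> by simp
  qed
  then show ?thesis
    unfolding best_const_def trig_poly_def[symmetric, abs_def]
    by (intro arg_cong[where f = Inf] Collect_cong) blast
qed

text \<open>Dropping the equation lets the sum over tuples factor. The bound shows that some
  constant is admissible, so that the infimum is meaningful, and that vanishing weights have energy
  0.\<close>

lemma energy_trivial_bound: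
  assumes "finite S" "n \<ge> 1" "\<And>l. l \<in> S \<Longrightarrow> 0 \<le> a l"
  shows "energy n S a \<le> real (card S) ^ (2 * n) * (\<Sum>l\<in>S. (a l)\<^sup>2) ^ n"
proof -
  have "energy n S a \<le> (\<Sum>g\<in>{..<2 * n} \<rightarrow>\<^sub>E S. \<Prod>i<2 * n. a (g i))"
    unfolding mixed_energy_def tuples_def
    using assms by (intro sum_mono2 finite_PiE prod_nonneg) auto
  also have "\<dots> = (\<Sum>l\<in>S. a l) ^ (2 * n)"
    using assms by (subst prod_sum_PiE[symmetric]) auto
  also have "\<dots> \<le> (real (card S) * sqrt (\<Sum>l\<in>S. (a l)\<^sup>2)) ^ (2 * n)"
  proof (intro power_mono sum_bounded_above sum_nonneg)
    fix l assume "l \<in> S"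
    then show "a l \<le> sqrt (\<Sum>l\<in>S. (a l)\<^sup>2)"
      using assms member_le_sum[of l S "\<lambda>l. (a l)\<^sup>2"] by (intro real_le_rsqrt) auto
  qed (use assms in auto)
  finally show ?thesis
    by (simp add: power_mult_distrib power_mult sum_nonneg)
qed

text \<open>The infimum is itself admissible: for fixed \<open>a\<close> with nonzero square sum,
  every admissible constant is at least the \<open>2 * n\<close>-th root of the normalised energy
  \<open>E\<close>, hence so is the infimum.\<close>

lemma best_const_upper:
  assumes "finite S" "n \<ge> 1" "\<And>l. l \<in> S \<Longrightarrow> 0 \<le> a l"
  shows "energy n S a \<le> best_const (real (2 * n)) S ^ (2 * n) * (\<Sum>l\<in>S. (a l)\<^sup>2) ^ n"
proof (cases "(\<Sum>l\<in>S. (a l)\<^sup>2) = 0")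
  case True
  then show ?thesis
    using energy_trivial_bound[of S n a, OF assms] \<open>n \<ge> 1\<close> by (simp add: zero_power)
next
  case False
  define s where "s = (\<Sum>l\<in>S. (a l)\<^sup>2)"
  have s: "s > 0" using False by (simp add: s_def sum_nonneg order_less_le)
  define E where "E = energy n S a / s ^ n"
  have E0: "0 \<le> E"
    unfolding E_def using s assms by (auto intro!: divide_nonneg_pos mixed_energy_nonneg)
  have "root (2 * n) E \<le> best_const (real (2 * n)) S"
    unfolding best_const_energy[OF assms(1,2)]
  proof (rule cInf_greatest)
    show "{C. 0 \<le> C \<and> (\<forall>a. (\<forall>l\<in>S. 0 \<le> a l) \<longrightarrow>
        energy n S a \<le> C ^ (2 * n) * (\<Sum>l\<in>S. (a l)\<^sup>2) ^ n)} \<noteq> {}"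
      using energy_trivial_bound[OF assms(1,2)]
      by (auto intro!: exI[of _ "real (card S)"])
  next
    fix C assume C: "C \<in> {C. 0 \<le> C \<and> (\<forall>a. (\<forall>l\<in>S. 0 \<le> a l) \<longrightarrow>
        energy n S a \<le> C ^ (2 * n) * (\<Sum>l\<in>S. (a l)\<^sup>2) ^ n)}"
    then have "energy n S a \<le> C ^ (2 * n) * s ^ n" using assms unfolding s_def by blast
    then have "E \<le> C ^ (2 * n)" using s by (simp add: E_def field_simps)
    then have "root (2 * n) E \<le> root (2 * n) (C ^ (2 * n))" using \<open>n \<ge> 1\<close> by simp
    also have "\<dots> = C" using C \<open>n \<ge> 1\<close> by (intro real_root_power_cancel) auto
    finally show "root (2 * n) E \<le> C" .
  qed
  then have "root (2 * n) E ^ (2 * n) \<le> best_const (real (2 * n)) S ^ (2 * n)"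
    using E0 \<open>n \<ge> 1\<close> by (intro power_mono real_root_ge_zero) auto
  then have "E \<le> best_const (real (2 * n)) S ^ (2 * n)"
    using E0 \<open>n \<ge> 1\<close> by (simp add: real_root_pow_pos2)
  then show ?thesis using s unfolding s_def[symmetric] by (simp add: E_def field_simps)
qed

lemma best_const_least:
  assumes "finite S" "n \<ge> 1" "0 \<le> C"
    and "\<And>a. (\<And>l. l \<in> S \<Longrightarrow> 0 \<le> a l) \<Longrightarrow>
      energy n S a \<le> C ^ (2 * n) * (\<Sum>l\<in>S. (a l)\<^sup>2) ^ n"
  shows "best_const (real (2 * n)) S \<le> C"
  unfolding best_const_energy[OF assms(1,2)]
  using assms by (intro cInf_lower bdd_belowI[of _ 0]) auto

text \<open>A unit mass at one point already forces this. It later justifies dividing by best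
  constants and taking their logarithms.\<close>

lemma best_const_ge_1:
  assumes "finite S" "n \<ge> 1" "S \<noteq> {}"
  shows "1 \<le> best_const (real (2 * n)) S"
proof -
  obtain l0 where l0: "l0 \<in> S" using assms by blast
  define a where "a l = (if l = l0 then 1 else 0 :: real)" for l
  have sum_a: "(\<Sum>l\<in>S. (a l)\<^sup>2) = 1"
    using l0 assms(1) by (simp add: a_def if_distrib[of "\<lambda>x. x\<^sup>2"] cong: if_cong)
  have one_le: "1 \<le> C" if "0 \<le> C" and "energy n S a \<le> C ^ (2 * n)" for C
  proof -
    \<comment> \<open>The constant tuple solves the equation because its signs cancel.\<close>
    define g where "g = (\<lambda>i\<in>{..<2 * n}. l0)"
    have "signed_sum n g = (\<Sum>i=0..<n. l0) + (\<Sum>i=n..<2 * n. - l0)"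
      unfolding signed_sum_def lessThan_atLeast0
      by (subst sum.atLeastLessThan_concat[of 0 n "2 * n", symmetric]) (auto simp: g_def)
    then have "g \<in> tuples n S 0" using l0 by (simp add: tuples_def g_def)
    then have "(\<Prod>i<2 * n. a (g i)) \<le> energy n S a"
      unfolding mixed_energy_def using assms(1)
      by (intro member_le_sum) (auto simp: a_def intro!: prod_nonneg)
    then have "1 \<le> C ^ (2 * n)" using that(2) by (simp add: g_def a_def)
    then show ?thesis using that(1) assms(2) power_less_one_iff[of C "2 * n"] by linarith
  qed
  have E: "energy n S a \<le> C ^ (2 * n)"
    if "\<forall>a. (\<forall>l\<in>S. 0 \<le> a l) \<longrightarrow> energy n S a \<le> C ^ (2 * n) * (\<Sum>l\<in>S. (a l)\<^sup>2) ^ n" for C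
    using that[rule_format, of a] sum_a by (simp add: a_def)
  show ?thesis
    unfolding best_const_energy[OF assms(1,2)]
  proof (rule cInf_greatest)
    show "{C. 0 \<le> C \<and> (\<forall>a. (\<forall>l\<in>S. 0 \<le> a l) \<longrightarrow>
        energy n S a \<le> C ^ (2 * n) * (\<Sum>l\<in>S. (a l)\<^sup>2) ^ n)} \<noteq> {}"
      using energy_trivial_bound[OF assms(1,2)]
      by (auto intro!: exI[of _ "real (card S)"])
  qed (use one_le E in blast)
qed

section \<open>Splitting into low and high digits; supermultiplicativity\<close>

lemma mixed_energy_scale:
  "mixed_energy n S h (\<lambda>i l. w i * a i l) = (\<Prod>i<2 * n. w i) * mixed_energy n S h a"
  by (simp add: mixed_energy_def prod.distrib sum_distrib_left)

lemma mixed_energy_cong: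
  assumes "\<And>i l. i < 2 * n \<Longrightarrow> l \<in> S \<Longrightarrow> a i l = b i l"
  shows "mixed_energy n S h a = mixed_energy n S h b"
  unfolding mixed_energy_def tuples_def
  using assms by (intro sum.cong prod.cong) (auto simp: PiE_iff)


text \<open>A solution over the combined set splits uniquely into low parts \<open>l\<close> and
  high parts \<open>m\<close>, and its signed sum is that of \<open>l\<close> plus \<open>Q\<close>
  times that of \<open>m\<close>. For fixed \<open>m\<close> the equation thus prescribes the signed
  sum of \<open>l\<close>, and variable \<open>i\<close> is weighted by the fibre of
  \<open>a\<close> over \<open>m i\<close>.\<close>

lemma energy_decompose:
  assumes fin: "finite S" "finite U" and inj: "inj_on (\<lambda>(l, m). l + Q * m) (S \<times> U)"
  shows "energy n ((\<lambda>(l, m). l + Q * m) ` (S \<times> U)) a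
    = (\<Sum>m\<in>{..<2 * n} \<rightarrow>\<^sub>E U. mixed_energy n S (- Q * signed_sum n m) (\<lambda>i l. a (l + Q * m i)))"
proof -
  let ?I = "{..<2 * n}"
  let ?T = "(\<lambda>(l, m). l + Q * m) ` (S \<times> U)"
  \<comment> \<open>\<open>J\<close> glues low and high parts; the restriction to \<open>?I\<close>
    keeps the result extensional, as \<open>tuples\<close> demands.\<close>
  define J where "J = (\<lambda>(m, l). \<lambda>i\<in>?I. l i + Q * (m i :: int))"
  have signed: "signed_sum n (J (m, l)) = signed_sum n l + Q * signed_sum n m" for l m
    by (auto simp: signed_sum_def J_def sum_distrib_left sum.distrib[symmetric] algebra_simps
        intro!: sum.cong)
  have bij: "bij_betw J (SIGMA m:?I \<rightarrow>\<^sub>E U. tuples n S (- Q * signed_sum n m)) (tuples n ?T 0)"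
  proof (rule bij_betw_imageI)
    show "inj_on J (SIGMA m:?I \<rightarrow>\<^sub>E U. tuples n S (- Q * signed_sum n m))"
    proof (rule inj_onI, clarify)
      fix m l m' l'
      assume m: "m \<in> ?I \<rightarrow>\<^sub>E U" "m' \<in> ?I \<rightarrow>\<^sub>E U"
        and l: "l \<in> tuples n S (- Q * signed_sum n m)" "l' \<in> tuples n S (- Q * signed_sum n m')"
        and eq: "J (m, l) = J (m', l')"
      have l': "l \<in> ?I \<rightarrow>\<^sub>E S" "l' \<in> ?I \<rightarrow>\<^sub>E S" using l by (auto simp: tuples_def)
      have "(l i, m i) = (l' i, m' i)" if "i \<in> ?I" for i
      proof (rule inj_onD[OF inj])
        show "(case (l i, m i) of (l, m) \<Rightarrow> l + Q * m) = (case (l' i, m' i) of (l, m) \<Rightarrow> l + Q * m)"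
          using fun_cong[OF eq, of i] that by (simp add: J_def)
      qed (use m l' that in auto)
      then show "m = m' \<and> l = l'"
        using PiE_ext[OF m] PiE_ext[OF l'] by simp
    qed
    show "J ` (SIGMA m:?I \<rightarrow>\<^sub>E U. tuples n S (- Q * signed_sum n m)) = tuples n ?T 0"
    proof (intro equalityI subsetI)
      fix g assume g: "g \<in> tuples n ?T 0"
      then have gPiE: "g \<in> ?I \<rightarrow>\<^sub>E ?T" by (simp add: tuples_def)
      have gT: "\<forall>i\<in>?I. \<exists>p. p \<in> S \<times> U \<and> g i = fst p + Q * snd p"
      proof
        fix i assume "i \<in> ?I"
        with gPiE have "g i \<in> ?T" by (rule PiE_mem)
        then show "\<exists>p. p \<in> S \<times> U \<and> g i = fst p + Q * snd p"
          unfolding image_iff case_prod_beta by blast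
      qed
      obtain p where p: "\<And>i. i \<in> ?I \<Longrightarrow> p i \<in> S \<times> U \<and> g i = fst (p i) + Q * snd (p i)"
        using bchoice[OF gT] by blast
      define l where "l = (\<lambda>i\<in>?I. fst (p i))"
      define m where "m = (\<lambda>i\<in>?I. snd (p i))"
      have lm: "l \<in> ?I \<rightarrow>\<^sub>E S" "m \<in> ?I \<rightarrow>\<^sub>E U"
        using p by (auto simp: l_def m_def mem_Times_iff)
      have gJ: "g = J (m, l)"
      proof
        fix i
        show "g i = J (m, l) i"
          using p[of i] PiE_arb[OF gPiE, of i] by (cases "i \<in> ?I") (simp_all add: J_def l_def m_def)
      qed
      then have "signed_sum n l = - Q * signed_sum n m"
        using signed[of m l] g by (simp add: tuples_def)
      with lm have "(m, l) \<in> (SIGMA m:?I \<rightarrow>\<^sub>E U. tuples n S (- Q * signed_sum n m))"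
        by (simp add: tuples_def)
      then show "g \<in> J ` (SIGMA m:?I \<rightarrow>\<^sub>E U. tuples n S (- Q * signed_sum n m))"
        unfolding gJ by (rule imageI)
    next
      fix g assume "g \<in> J ` (SIGMA m:?I \<rightarrow>\<^sub>E U. tuples n S (- Q * signed_sum n m))"
      then obtain m l where ml: "m \<in> ?I \<rightarrow>\<^sub>E U" "l \<in> tuples n S (- Q * signed_sum n m)"
        and g: "g = J (m, l)" by blast
      have "g i \<in> ?T" if "i \<in> ?I" for i
      proof -
        have "(l i, m i) \<in> S \<times> U" using ml that by (auto simp: tuples_def PiE_iff)
        then show ?thesis using that by (auto simp: g J_def intro: image_eqI[of _ _ "(l i, m i)"])
      qed
      then have "g \<in> ?I \<rightarrow>\<^sub>E ?T" by (auto simp: g J_def)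
      then show "g \<in> tuples n ?T 0" using ml signed[of m l] by (simp add: g tuples_def)
    qed
  qed
  have "energy n ?T a = (\<Sum>p\<in>(SIGMA m:?I \<rightarrow>\<^sub>E U. tuples n S (- Q * signed_sum n m)).
      \<Prod>i<2 * n. a (J p i))"
    unfolding mixed_energy_def by (rule sum.reindex_bij_betw[OF bij, symmetric])
  also have "\<dots> = (\<Sum>m\<in>?I \<rightarrow>\<^sub>E U. \<Sum>l\<in>tuples n S (- Q * signed_sum n m). \<Prod>i<2 * n. a (J (m, l) i))"
    using sum.Sigma[of "?I \<rightarrow>\<^sub>E U" "\<lambda>m. tuples n S (- Q * signed_sum n m)"
        "\<lambda>m l. \<Prod>i<2 * n. a (J (m, l) i)"] fin
    by (simp add: finite_PiE case_prod_beta)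
  also have "\<dots> = (\<Sum>m\<in>?I \<rightarrow>\<^sub>E U. \<Sum>l\<in>tuples n S (- Q * signed_sum n m). \<Prod>i<2 * n. a (l i + Q * m i))"
    by (intro sum.cong prod.cong refl) (simp add: J_def)
  finally show ?thesis unfolding mixed_energy_def .
qed

text \<open>For the product weight \<open>a l * b m\<close>, square sums multiply exactly, while
  pairs of solutions over \<open>S\<close> and \<open>U\<close> are among the solutions over
  \<open>T\<close>. Optimising first over \<open>a\<close> and then over \<open>b\<close> turns this
  into a bound for the constants.\<close>

lemma best_const_supermult:
  assumes fin: "finite S" "finite U" and inj: "inj_on (\<lambda>(l, m). l + Q * m) (S \<times> U)"
    and n: "n \<ge> 1" and ne: "S \<noteq> {}" "U \<noteq> {}"
  defines "T \<equiv> (\<lambda>(l, m). l + Q * m) ` (S \<times> U)"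
  shows "best_const (real (2 * n)) S * best_const (real (2 * n)) U \<le> best_const (real (2 * n)) T"
proof -
  let ?A = "best_const (real (2 * n)) S" and ?B = "best_const (real (2 * n)) U"
    and ?C = "best_const (real (2 * n)) T"
  have finT: "finite T" using fin by (simp add: T_def)
  have A1: "1 \<le> ?A" by (rule best_const_ge_1[OF fin(1) n ne(1)])
  have C0: "0 \<le> ?C"
    using best_const_ge_1[OF finT n] ne by (auto simp: T_def)
  have prod_le: "energy n S a * energy n U b
      \<le> ?C ^ (2 * n) * ((\<Sum>l\<in>S. (a l)\<^sup>2) ^ n * (\<Sum>m\<in>U. (b m)\<^sup>2) ^ n)"
    if a: "\<And>l. l \<in> S \<Longrightarrow> 0 \<le> a l" and b: "\<And>m. m \<in> U \<Longrightarrow> 0 \<le> b m" for a b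
  proof -
    \<comment> \<open>The product weight is transported to \<open>T\<close> by reading off the
      unique pair \<open>(l, m)\<close>.\<close>
    define c where "c y = (case the_inv_into (S \<times> U) (\<lambda>(l, m). l + Q * m) y of (l, m) \<Rightarrow> a l * b m)" for y
    have c: "c (l + Q * m) = a l * b m" if "l \<in> S" "m \<in> U" for l m
      using the_inv_into_f_f[OF inj, of "(l, m)"] that by (simp add: c_def)
    have c0: "0 \<le> c y" if "y \<in> T" for y
      using that a b by (auto simp: T_def c)
    have "energy n S a * energy n U b
        = (\<Sum>m\<in>tuples n U 0. mixed_energy n S (- Q * signed_sum n m) (\<lambda>i l. c (l + Q * m i)))"
    proof -
      have "energy n S a * energy n U b = (\<Sum>m\<in>tuples n U 0. (\<Prod>i<2 * n. b (m i)) * energy n S a)"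
        unfolding mixed_energy_def[of n U] by (subst mult.commute) (rule sum_distrib_right)
      also have "\<dots> = (\<Sum>m\<in>tuples n U 0.
          mixed_energy n S (- Q * signed_sum n m) (\<lambda>i l. c (l + Q * m i)))"
      proof (rule sum.cong[OF refl])
        fix m assume m: "m \<in> tuples n U 0"
        then have "mixed_energy n S 0 (\<lambda>i l. c (l + Q * m i)) = mixed_energy n S 0 (\<lambda>i l. b (m i) * a l)"
          by (intro mixed_energy_cong) (auto simp: tuples_def PiE_iff c)
        then show "(\<Prod>i<2 * n. b (m i)) * energy n S a
            = mixed_energy n S (- Q * signed_sum n m) (\<lambda>i l. c (l + Q * m i))"
          using m by (simp add: mixed_energy_scale tuples_def)
      qed
      finally show ?thesis .
    qed
    \<comment> \<open>Only high parts with signed sum 0 were kept; the remaining terms are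
      nonnegative.\<close>
    also have "\<dots> \<le> energy n T c"
      unfolding T_def energy_decompose[OF fin inj]
    proof (rule sum_mono2)
      fix m assume "m \<in> ({..<2 * n} \<rightarrow>\<^sub>E U) - tuples n U 0"
      then show "0 \<le> mixed_energy n S (- Q * signed_sum n m) (\<lambda>i l. c (l + Q * m i))"
        by (intro mixed_energy_nonneg c0) (auto simp: T_def PiE_iff)
    qed (use fin in \<open>auto simp: tuples_def finite_PiE\<close>)
    also have "\<dots> \<le> ?C ^ (2 * n) * (\<Sum>y\<in>T. (c y)\<^sup>2) ^ n"
      by (rule best_const_upper[OF finT n c0])
    also have "(\<Sum>y\<in>T. (c y)\<^sup>2) = (\<Sum>(l, m)\<in>S \<times> U. (a l * b m)\<^sup>2)"
      unfolding T_def by (subst sum.reindex[OF inj]) (auto intro!: sum.cong simp: c)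
    also have "\<dots> = (\<Sum>l\<in>S. (a l)\<^sup>2) * (\<Sum>m\<in>U. (b m)\<^sup>2)"
      by (simp add: sum_product sum.cartesian_product power_mult_distrib)
    finally show ?thesis by (simp add: power_mult_distrib)
  qed
  \<comment> \<open>With \<open>b\<close> fixed, dividing \<open>prod_le\<close> by the energy of
    \<open>b\<close> exhibits an admissible constant for \<open>S\<close>.\<close>
  have U_bound: "?A ^ (2 * n) * energy n U b \<le> ?C ^ (2 * n) * (\<Sum>m\<in>U. (b m)\<^sup>2) ^ n"
    if b: "\<And>m. m \<in> U \<Longrightarrow> 0 \<le> b m" for b
  proof (cases "energy n U b = 0")
    case True
    then show ?thesis using C0 by (simp add: sum_nonneg)
  next
    case False
    define e where "e = energy n U b"
    have e: "e > 0"
      using False mixed_energy_nonneg[of n U "\<lambda>_. b" 0] b by (simp add: e_def order_less_le)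
    define R where "R = ?C ^ (2 * n) * (\<Sum>m\<in>U. (b m)\<^sup>2) ^ n"
    have R: "0 \<le> R / e" using C0 e by (simp add: R_def sum_nonneg)
    have root_pow: "root (2 * n) (R / e) ^ (2 * n) = R / e"
      using R n by (simp add: real_root_pow_pos2)
    have "?A \<le> root (2 * n) (R / e)"
    proof (rule best_const_least[OF fin(1) n])
      fix a :: "int \<Rightarrow> real" assume "\<And>l. l \<in> S \<Longrightarrow> 0 \<le> a l"
      then have "energy n S a * e \<le> R * (\<Sum>l\<in>S. (a l)\<^sup>2) ^ n"
        using prod_le[of a b] b by (simp add: e_def R_def mult_ac)
      then show "energy n S a \<le> root (2 * n) (R / e) ^ (2 * n) * (\<Sum>l\<in>S. (a l)\<^sup>2) ^ n"
        unfolding root_pow using e by (simp add: field_simps)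
    qed (use R n in simp)
    then have "?A ^ (2 * n) \<le> root (2 * n) (R / e) ^ (2 * n)"
      using A1 by (intro power_mono) auto
    then have "?A ^ (2 * n) \<le> R / e" unfolding root_pow .
    then show ?thesis using e by (simp add: field_simps R_def e_def)
  qed
  have "?B \<le> ?C / ?A"
  proof (rule best_const_least[OF fin(2) n])
    fix b :: "int \<Rightarrow> real" assume "\<And>l. l \<in> U \<Longrightarrow> 0 \<le> b l"
    from U_bound[OF this] show "energy n U b \<le> (?C / ?A) ^ (2 * n) * (\<Sum>l\<in>U. (b l)\<^sup>2) ^ n"
      using A1 by (simp add: power_divide field_simps)
  qed (use A1 C0 in simp)
  then show ?thesis using A1 by (simp add: field_simps)
qed

section \<open>Carries and submultiplicativity\<close>

text \<open>Each half of the sum lies between 0 and \<open>n * (Q - 1)\<close>. If the signed sum is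
  a multiple \<open>h * Q\<close>, strictness leaves only carries with
  \<open>\<bar>h\<bar> < n\<close>.\<close>

lemma abs_signed_sum_less:
  assumes "g \<in> {..<2 * n} \<rightarrow>\<^sub>E {0..<Q}" and "n \<ge> 1"
  shows "\<bar>signed_sum n g\<bar> < int n * Q"
proof -
  have "signed_sum n g = (\<Sum>i=0..<n. g i) + (\<Sum>i=n..<2 * n. - g i)"
    unfolding signed_sum_def lessThan_atLeast0
    by (subst sum.atLeastLessThan_concat[of 0 n "2 * n", symmetric]) auto
  moreover have bound: "0 \<le> g i" "g i \<le> Q - 1" if "i < 2 * n" for i
    using assms(1) that by (force simp: PiE_iff)+
  have "0 \<le> (\<Sum>i=0..<n. g i)" "0 \<le> (\<Sum>i=n..<2 * n. g i)"
    by (intro sum_nonneg bound; simp)+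
  moreover have "(\<Sum>i=0..<n. g i) \<le> int (card {0..<n}) * (Q - 1)"
    "(\<Sum>i=n..<2 * n. g i) \<le> int (card {n..<2 * n}) * (Q - 1)"
    by (intro sum_bounded_above bound; simp)+
  ultimately show ?thesis using \<open>n \<ge> 1\<close> by (simp add: sum_negf algebra_simps)
qed

text \<open>The low part is the remainder modulo \<open>Q\<close>.\<close>

lemma inj_on_digit_shift:
  fixes Q :: int
  assumes "S \<subseteq> {0..<Q}"
  shows "inj_on (\<lambda>(l, m). l + Q * m) (S \<times> U)"
proof (rule inj_onI, clarify)
  fix l m l' m'
  assume *: "l \<in> S" "l' \<in> S" and eq: "l + Q * m = l' + Q * m'"
  have "l = (l + Q * m) mod Q" "l' = (l' + Q * m') mod Q" using * assms by auto
  then have "l = l'" using eq by simp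
  moreover have "Q \<noteq> 0" using * assms by auto
  ultimately show "l = l' \<and> m = m'" using eq by simp
qed

text \<open>Carries enter here: the low digits of a solution have signed sum \<open>h * Q\<close> with \<open>\<bar>h\<bar> < n\<close>, and
  each of the \<open>2 * n - 1\<close> values of \<open>h\<close> contributes at most the bound for \<open>h = 0\<close>.\<close>

lemma best_const_submult:
  assumes fin: "finite U" and S: "S \<subseteq> {0..<Q}"
    and n: "n \<ge> 1" and ne: "S \<noteq> {}" "U \<noteq> {}"
  defines "T \<equiv> (\<lambda>(l, m). l + Q * m) ` (S \<times> U)"
  shows "best_const (real (2 * n)) T ^ (2 * n)
    \<le> real (2 * n - 1) * (best_const (real (2 * n)) S * best_const (real (2 * n)) U) ^ (2 * n)"
proof -
  let ?A = "best_const (real (2 * n)) S" and ?B = "best_const (real (2 * n)) U"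
  have inj: "inj_on (\<lambda>(l, m). l + Q * m) (S \<times> U)" by (rule inj_on_digit_shift[OF S])
  have finS: "finite S" using S finite_subset by blast
  have finT: "finite T" using fin finS by (simp add: T_def)
  have A1: "1 \<le> ?A" by (rule best_const_ge_1[OF finS n ne(1)])
  have B1: "1 \<le> ?B" by (rule best_const_ge_1[OF fin n ne(2)])
  let ?PU = "{..<2 * n} \<rightarrow>\<^sub>E U"
  have main: "energy n T a \<le> real (2 * n - 1) * (?A * ?B) ^ (2 * n) * (\<Sum>y\<in>T. (a y)\<^sup>2) ^ n"
    if a: "\<And>y. y \<in> T \<Longrightarrow> 0 \<le> a y" for a
  proof -
    \<comment> \<open>The Euclidean norm of the fibre of \<open>a\<close> over \<open>m\<close>:
      these norms serve as weights on \<open>U\<close>, with the same total square sum as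
      \<open>a\<close>.\<close>
    define b where "b m = sqrt (\<Sum>l\<in>S. (a (l + Q * m))\<^sup>2)" for m
    have b0: "0 \<le> b m" for m by (simp add: b_def sum_nonneg)
    have sum_b: "(\<Sum>m\<in>U. (b m)\<^sup>2) = (\<Sum>y\<in>T. (a y)\<^sup>2)"
    proof -
      have "(\<Sum>m\<in>U. (b m)\<^sup>2) = (\<Sum>m\<in>U. \<Sum>l\<in>S. (a (l + Q * m))\<^sup>2)"
        by (simp add: b_def sum_nonneg)
      also have "\<dots> = (\<Sum>(l, m)\<in>S \<times> U. (a (l + Q * m))\<^sup>2)"
        by (subst sum.swap) (simp add: sum.cartesian_product)
      also have "\<dots> = (\<Sum>y\<in>T. (a y)\<^sup>2)"
        unfolding T_def by (subst sum.reindex[OF inj]) (auto intro!: sum.cong)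
      finally show ?thesis .
    qed
    \<comment> \<open>After each fibre is divided by its norm, all energies are at most
      \<open>?A ^ (2 * n)\<close>, so \<open>mixed_energy_le\<close> applies uniformly in
      \<open>h\<close>; the norms are then multiplied back.\<close>
    have fibre: "mixed_energy n S h (\<lambda>i l. a (l + Q * m i)) \<le> ?A ^ (2 * n) * (\<Prod>i<2 * n. b (m i))"
      if m: "m \<in> ?PU" for m h
    proof -
      define w where "w i l = a (l + Q * m i) / b (m i)" for i l
      have mU: "m i \<in> U" if "i < 2 * n" for i using m that by (auto simp: PiE_iff)
      have w0: "0 \<le> w i l" if "i < 2 * n" "l \<in> S" for i l
        unfolding w_def using that mU b0 by (intro divide_nonneg_nonneg a) (auto simp: T_def)
      \<comment> \<open>If the norm is 0, the whole fibre vanishes, so the factorisation survives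
        division by zero.\<close>
      have "a (l + Q * m i) = b (m i) * w i l" if "l \<in> S" for i l
      proof (cases "b (m i) = 0")
        case True
        then have "(\<Sum>l\<in>S. (a (l + Q * m i))\<^sup>2) = 0" by (simp add: b_def)
        then show ?thesis using that finS True by (simp add: sum_nonneg_eq_0_iff)
      qed (simp add: w_def)
      then have "mixed_energy n S h (\<lambda>i l. a (l + Q * m i))
          = (\<Prod>i<2 * n. b (m i)) * mixed_energy n S h w"
        by (simp add: mixed_energy_scale[symmetric] cong: mixed_energy_cong)
      moreover have "mixed_energy n S h w \<le> ?A ^ (2 * n)"
      proof (rule mixed_energy_le[OF finS n w0])
        fix i assume i: "i < 2 * n"
        \<comment> \<open>The quotient is 1, or 0 for a vanishing fibre.\<close>
        have "(\<Sum>l\<in>S. (w i l)\<^sup>2) = (b (m i))\<^sup>2 / (b (m i))\<^sup>2"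
          by (simp add: w_def power_divide sum_divide_distrib[symmetric] b_def sum_nonneg)
        also have "\<dots> \<le> 1" by simp
        finally have "(\<Sum>l\<in>S. (w i l)\<^sup>2) ^ n \<le> 1" by (intro power_le_one sum_nonneg) auto
        then have "?A ^ (2 * n) * (\<Sum>l\<in>S. (w i l)\<^sup>2) ^ n \<le> ?A ^ (2 * n)"
          using A1 by (intro mult_left_le) auto
        moreover have "energy n S (w i) \<le> ?A ^ (2 * n) * (\<Sum>l\<in>S. (w i l)\<^sup>2) ^ n"
          using w0[OF i] by (rule best_const_upper[OF finS n])
        ultimately show "energy n S (w i) \<le> ?A ^ (2 * n)" by linarith
      qed
      moreover have "0 \<le> (\<Prod>i<2 * n. b (m i))" by (intro prod_nonneg) (simp add: b0)
      ultimately show ?thesis by (metis mult.commute mult_right_mono)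
    qed
    let ?H = "{- int n + 1..int n - 1}"
    let ?M = "{m \<in> ?PU. signed_sum n m \<in> ?H}"
    have finM: "finite ?M" using fin by (simp add: finite_PiE)
    have "energy n T a
        = (\<Sum>m\<in>?PU. mixed_energy n S (- Q * signed_sum n m) (\<lambda>i l. a (l + Q * m i)))"
      unfolding T_def by (rule energy_decompose[OF finS fin inj])
    \<comment> \<open>High parts with signed sum of modulus at least \<open>n\<close> would need low
      parts with signed sum of modulus at least \<open>n * Q\<close>, which is impossible.\<close>
    also have "\<dots> = (\<Sum>m\<in>?M. mixed_energy n S (- Q * signed_sum n m) (\<lambda>i l. a (l + Q * m i)))"
    proof (rule sum.mono_neutral_right)
      show "\<forall>m\<in>?PU - ?M. mixed_energy n S (- Q * signed_sum n m) (\<lambda>i l. a (l + Q * m i)) = 0"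
      proof
        fix m assume "m \<in> ?PU - ?M"
        then have m: "int n \<le> \<bar>signed_sum n m\<bar>" by simp linarith
        have "tuples n S (- Q * signed_sum n m) = {}"
        proof (rule ccontr)
          assume "tuples n S (- Q * signed_sum n m) \<noteq> {}"
          then obtain g where g: "g \<in> {..<2 * n} \<rightarrow>\<^sub>E S" "signed_sum n g = - Q * signed_sum n m"
            unfolding tuples_def by blast
          have "g \<in> {..<2 * n} \<rightarrow>\<^sub>E {0..<Q}" using g(1) S PiE_mono[of "{..<2 * n}" "\<lambda>_. S"] by blast
          then have "\<bar>- Q * signed_sum n m\<bar> < int n * Q"
            unfolding g(2)[symmetric] using n by (rule abs_signed_sum_less)
          then have "\<bar>Q\<bar> * \<bar>signed_sum n m\<bar> < int n * Q" by (simp add: abs_mult)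
          moreover have "\<bar>Q\<bar> * int n \<le> \<bar>Q\<bar> * \<bar>signed_sum n m\<bar>" using m by (intro mult_left_mono) simp_all
          moreover have "0 < Q" using S ne by auto
          ultimately show False by (simp add: mult.commute)
        qed
        then show "mixed_energy n S (- Q * signed_sum n m) (\<lambda>i l. a (l + Q * m i)) = 0"
          by (simp add: mixed_energy_def)
      qed
      show "finite ?PU" using fin by (simp add: finite_PiE)
    qed blast
    also have "\<dots> \<le> (\<Sum>m\<in>?M. ?A ^ (2 * n) * (\<Prod>i<2 * n. b (m i)))"
      by (intro sum_mono fibre) auto
    also have "\<dots> = ?A ^ (2 * n) * (\<Sum>m\<in>?M. \<Prod>i<2 * n. b (m i))"
      by (simp add: sum_distrib_left)
    finally have low: "energy n T a \<le> ?A ^ (2 * n) * (\<Sum>m\<in>?M. \<Prod>i<2 * n. b (m i))" .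
    \<comment> \<open>The surviving high parts are grouped by carry; each group is a full solution
      set over \<open>U\<close> with right-hand side \<open>h\<close>.\<close>
    have "(\<Sum>m\<in>?M. \<Prod>i<2 * n. b (m i))
        = (\<Sum>h\<in>?H. \<Sum>m\<in>{m\<in>?M. signed_sum n m = h}. \<Prod>i<2 * n. b (m i))"
    proof (rule sum.group[symmetric, OF finM])
      show "signed_sum n ` ?M \<subseteq> ?H" by blast
    qed simp
    also have "\<dots> = (\<Sum>h\<in>?H. mixed_energy n U h (\<lambda>_. b))"
    proof (rule sum.cong[OF refl])
      fix h assume "h \<in> ?H"
      then have "{m \<in> ?M. signed_sum n m = h} = tuples n U h" unfolding tuples_def by blast
      then show "(\<Sum>m\<in>{m\<in>?M. signed_sum n m = h}. \<Prod>i<2 * n. b (m i)) = mixed_energy n U h (\<lambda>_. b)"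
        by (simp only: mixed_energy_def)
    qed
    \<comment> \<open>With equal weights, \<open>mixed_energy_le\<close> says that no
      \<open>h\<close> has more weighted solutions than \<open>h = 0\<close>.\<close>
    also have "\<dots> \<le> (\<Sum>h\<in>?H. energy n U b)"
      by (rule sum_mono, rule mixed_energy_le[OF fin n b0 order_refl])
    also have "\<dots> = real (2 * n - 1) * energy n U b"
      using n by (simp add: nat_diff_distrib)
    also have "\<dots> \<le> real (2 * n - 1) * (?B ^ (2 * n) * (\<Sum>m\<in>U. (b m)\<^sup>2) ^ n)"
      by (intro mult_left_mono best_const_upper[OF fin n b0]) simp
    finally have "?A ^ (2 * n) * (\<Sum>m\<in>?M. \<Prod>i<2 * n. b (m i))
        \<le> ?A ^ (2 * n) * (real (2 * n - 1) * (?B ^ (2 * n) * (\<Sum>y\<in>T. (a y)\<^sup>2) ^ n))"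
      unfolding sum_b using A1 by (intro mult_left_mono) auto
    with low show ?thesis by (simp add: power_mult_distrib mult_ac)
  qed
  let ?X = "real (2 * n - 1) * (?A * ?B) ^ (2 * n)"
  have X: "0 \<le> ?X" using A1 B1 by simp
  have pow: "root (2 * n) ?X ^ (2 * n) = ?X" using X n by (intro real_root_pow_pos2) auto
  have "best_const (real (2 * n)) T \<le> root (2 * n) ?X"
    by (rule best_const_least[OF finT n]) (use X n pow main in auto)
  moreover have "1 \<le> best_const (real (2 * n)) T"
    using best_const_ge_1[OF finT n] ne by (auto simp: T_def)
  ultimately have "best_const (real (2 * n)) T ^ (2 * n) \<le> root (2 * n) ?X ^ (2 * n)"
    by (intro power_mono) auto
  then show ?thesis unfolding pow .
qed

section \<open>The decoupling exponent as a limit\<close>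

theorem proposition3p7:
  fixes n k :: nat and q :: int and d :: "nat \<Rightarrow> int"
  assumes "n \<ge> 1" and "k \<ge> 2"
    and "strict_mono_on {1..k} d"
    and "\<And>i. i \<in> {1..k} \<Longrightarrow> 0 \<le> d i \<and> d i < q"
  shows "(\<forall>t::nat. t \<ge> 1 \<longrightarrow> real t > log (real_of_int q) (real n) \<longrightarrow>
            \<bar>decoupling_exponent (real (2 * n)) q (d ` {1..k})
               - ereal (ln (best_const (real (2 * n)) (ellipsephic_level q (d ` {1..k}) t))
                        / ln (real k ^ t))\<bar>
              \<le> ereal (ln (real (2 * n + 1)) / (real (2 * n) * real t * ln (real k))))
       \<and> (\<lambda>t. ereal (ln (best_const (real (2 * n)) (ellipsephic_level q (d ` {1..k}) t))
                        / ln (real k ^ t)))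
            \<longlonglongrightarrow> decoupling_exponent (real (2 * n)) q (d ` {1..k})"
proof -
  define D where "D = d ` {1..k}"
  define E where "E j = ellipsephic_level q D j" for j
  define A where "A j = best_const (real (2 * n)) (E j)" for j
  define L where "L j = ln (A j) / ln (real k)" for j
  define c where "c = ln (real (2 * n + 1)) / (real (2 * n) * ln (real k))"
  have card_D: "card D = k"
    unfolding D_def using assms(3) by (subst card_image) (auto intro: strict_mono_on_imp_inj_on)
  have D: "D \<noteq> {}" "\<And>x. x \<in> D \<Longrightarrow> 0 \<le> x \<and> x < q"
    using assms(2,4) by (auto simp: D_def)
  have E_sub: "E j \<subseteq> {0..<q ^ j}" for j
    unfolding E_def by (rule ellipsephic_level_subset[OF D(2)])
  then have E_fin: "finite (E j)" for j using finite_subset by blast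
  have E_ne: "E j \<noteq> {}" for j unfolding E_def by (rule ellipsephic_level_nonempty[OF D(1)])
  have A1: "1 \<le> A j" for j unfolding A_def by (rule best_const_ge_1[OF E_fin assms(1) E_ne])
  have lnk: "0 < ln (real k)" using assms(2) by simp
  note inj = inj_on_digit_shift[OF E_sub, of _ "E _"]
  have lower: "ln (A s) + ln (A t) \<le> ln (A (s + t))" for s t
  proof -
    have "A s * A t \<le> A (s + t)"
      using best_const_supermult[OF E_fin E_fin inj assms(1) E_ne E_ne, of s t]
      by (simp add: A_def E_def ellipsephic_level_add)
    then have "ln (A s * A t) \<le> ln (A (s + t))"
      using A1[of s] A1[of t] A1[of "s + t"] by (subst ln_le_cancel_iff) auto
    then show ?thesis using A1[of s] A1[of t] by (simp add: ln_mult)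
  qed
  have upper: "ln (A (s + t)) \<le> ln (A s) + ln (A t) + ln (real (2 * n + 1)) / real (2 * n)" for s t
  proof -
    have "A (s + t) ^ (2 * n) \<le> real (2 * n - 1) * (A s * A t) ^ (2 * n)"
      using best_const_submult[OF E_fin E_sub assms(1) E_ne E_ne, of s t]
      by (simp add: A_def E_def ellipsephic_level_add)
    \<comment> \<open>Counting carries gives \<open>2 * n - 1\<close>, which is relaxed to the
      constant of the stated error.\<close>
    also have "\<dots> \<le> real (2 * n + 1) * (A s * A t) ^ (2 * n)"
      using A1[of s] A1[of t] by (intro mult_right_mono) auto
    finally have "ln (A (s + t) ^ (2 * n)) \<le> ln (real (2 * n + 1) * (A s * A t) ^ (2 * n))"
      using A1[of s] A1[of t] A1[of "s + t"] by (subst ln_le_cancel_iff) auto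
    also have "\<dots> = ln (real (2 * n + 1)) + real (2 * n) * (ln (A s) + ln (A t))"
      using A1[of s] A1[of t] by (simp add: ln_mult ln_realpow del: of_nat_add of_nat_Suc)
    finally have "real (2 * n) * ln (A (s + t))
      \<le> ln (real (2 * n + 1)) + real (2 * n) * (ln (A s) + ln (A t))"
      using A1[of "s + t"] by (simp add: ln_realpow)
    then show ?thesis using assms(1) by (simp add: field_simps)
  qed
  have super: "L s + L t \<le> L (s + t)" for s t
    using lower[of s t] lnk unfolding L_def
    by (simp add: add_divide_distrib[symmetric] divide_right_mono)
  have sub: "L (s + t) \<le> L s + L t + c" for s t
  proof -
    have "L (s + t) \<le> (ln (A s) + ln (A t) + ln (real (2 * n + 1)) / real (2 * n)) / ln (real k)"
      unfolding L_def using upper lnk by (intro divide_right_mono) auto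
    then show ?thesis by (simp add: L_def c_def add_divide_distrib)
  qed
  obtain \<alpha> where lim: "(\<lambda>t. L t / real t) \<longlonglongrightarrow> \<alpha>"
    and err: "\<And>t. t \<ge> 1 \<Longrightarrow> \<bar>\<alpha> - L t / real t\<bar> \<le> c / real t"
    using two_sided_fekete[of L c] super sub by blast
  \<comment> \<open>At \<open>t = 0\<close> both sides are divisions by zero and equal 0.\<close>
  have quot: "ln (A t) / ln (real k ^ t) = L t / real t" for t
    using assms(2) by (simp add: L_def ln_realpow mult.commute)
  have lim': "(\<lambda>t. ereal (ln (A t) / ln (real k ^ t))) \<longlonglongrightarrow> ereal \<alpha>"
    unfolding quot using lim by simp
  \<comment> \<open>The upper limit of a convergent sequence is its limit, so the exponent is
    finite.\<close>
  have exponent: "decoupling_exponent (real (2 * n)) q D = ereal \<alpha>"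
    unfolding decoupling_exponent_def card_D
    using lim_imp_Limsup[OF _ lim'] by (simp add: A_def E_def)
  have "\<bar>ereal \<alpha> - ereal (ln (A t) / ln (real k ^ t))\<bar>
      \<le> ereal (ln (real (2 * n + 1)) / (real (2 * n) * real t * ln (real k)))"
    if "t \<ge> 1" for t
    using err[OF that] unfolding quot by (simp add: c_def mult_ac)
  with lim' show ?thesis
    unfolding exponent[unfolded D_def] A_def E_def D_def by blast
qed

end
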